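(* For any submodular function $f:\{0,1\}^n\to[0,1]$ and $\epsilon>0$, there is a polynomial $p$ of degree $O\!\left(\frac{1}{\epsilon^{4/5}}\log\frac{1}{\epsilon}\right)$ (with the implied constant independent of $n$ and $f$) such that $\|f-p\|_2\le\epsilon$.
   Context: $f$ is submodular if $f(A\cup B)+f(A\cap B)\le f(A)+f(B)$ for all $A,B\subseteq[n]$ (identifying $\{0,1\}^n$ with subsets of $[n]$). $\|g\|_2=\sqrt{\mathbb{E}_x[g(x)^2]}$ with $x$ uniform on $\{0,1\}^n$. *)

theory Defs
  imports "HOL-Probability.Probability" "HOL-Library.Poly_Mapping"
begin

text \<open>
  Points of the cube of dimension \<open>n\<close> are subsets of \<open>{1..n}\<close>; as a 0/1 vector, the set \<open>A\<close> is
  \<open>indicator A\<close>. A function on the cube is a function on \<open>nat set\<close> of which only the values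
  on \<open>Pow {1..n}\<close> matter.
\<close>

definition submodular_on :: "'a set \<Rightarrow> ('a set \<Rightarrow> real) \<Rightarrow> bool" where
  "submodular_on V f \<longleftrightarrow>
     (\<forall>A B. A \<subseteq> V \<longrightarrow> B \<subseteq> V \<longrightarrow> f (A \<union> B) + f (A \<inter> B) \<le> f A + f B)"

definition cube_l2_norm :: "nat \<Rightarrow> (nat set \<Rightarrow> real) \<Rightarrow> real" where
  "cube_l2_norm n g =
     sqrt (measure_pmf.expectation (pmf_of_set (Pow {1..n})) (\<lambda>A. (g A)\<^sup>2))"

text \<open>
  Multivariate polynomials are finitely supported maps from monomials to coefficients; a monomial is
  a finitely supported map from variable indices to exponents.
\<close>

type_synonym real_mpoly = "(nat \<Rightarrow>\<^sub>0 nat) \<Rightarrow>\<^sub>0 real"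

definition mpoly_vars :: "real_mpoly \<Rightarrow> nat set" where
  "mpoly_vars p = (\<Union>m\<in>Poly_Mapping.keys p. Poly_Mapping.keys m)"

definition mpoly_eval :: "real_mpoly \<Rightarrow> (nat \<Rightarrow> real) \<Rightarrow> real" where
  "mpoly_eval p x =
     (\<Sum>m\<in>Poly_Mapping.keys p. Poly_Mapping.lookup p m *
        (\<Prod>i\<in>Poly_Mapping.keys m. x i ^ Poly_Mapping.lookup m i))"

text \<open>Total degree; the zero polynomial gets degree 0.\<close>

definition mpoly_degree :: "real_mpoly \<Rightarrow> nat" where
  "mpoly_degree p =
     Max (insert 0 ((\<lambda>m. \<Sum>i\<in>Poly_Mapping.keys m. Poly_Mapping.lookup m i) `
                      Poly_Mapping.keys p))"

end

theory Submission imports Defs begin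

text \<open>
  Let \<open>\<alpha> = 1/m\<close> with \<open>m\<close> of order \<open>\<epsilon> powr (-4/5)\<close>. A decision tree of depth \<open>O(m)\<close> that always queries
  a coordinate whose marginal value exceeds \<open>\<alpha>\<close> in absolute value reduces \<open>f\<close> to \<open>\<alpha>\<close>-Lipschitz
  submodular functions, except on an exponentially small part of the cube. For such an \<open>f\<close>, truncation of the
  Walsh expansion at degree \<open>d\<close> costs at most a multiple of \<open>(\<Sum>i j. E (D\<^sub>i\<^sub>j f)\<^sup>2) / d\<^sup>2\<close>, and
  the second derivatives sum to \<open>O(sqrt \<alpha>)\<close>: as \<open>D\<^sub>i\<^sub>j f\<close> is a difference of values of \<open>D\<^sub>j f\<close>,
  \<open>E (D\<^sub>i\<^sub>j f)\<^sup>2 \<le> 2 E \<bar>D\<^sub>j f\<bar> \<bar>D\<^sub>i\<^sub>j f\<bar>\<close>, and since \<open>D\<^sub>i\<^sub>j f \<le> 0\<close>, the sum of these is controlled by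
  the correlation of \<open>G = \<Sum>i. D\<^sub>i f\<close>, whose second moment is \<open>O(1)\<close>, with a martingale of second moment \<open>O(\<alpha>)\<close>
  obtained by revealing the coordinates in increasing order. With \<open>d = O(m)\<close> the squared error is
  of order \<open>sqrt \<alpha> / m\<^sup>2 = m powr (-5/2) \<le> \<epsilon>\<^sup>2\<close>.
\<close>

subsection \<open>Fourier analysis on the cube\<close>

definition cube_avg :: "nat set \<Rightarrow> (nat set \<Rightarrow> real) \<Rightarrow> real" where
  "cube_avg V h = (\<Sum>A\<in>Pow V. h A) / 2 ^ card V"

lemma cube_avg_cong: "(\<And>A. A \<subseteq> V \<Longrightarrow> g A = h A) \<Longrightarrow> cube_avg V g = cube_avg V h"
  unfolding cube_avg_def by (metis (no_types, lifting) Pow_iff sum.cong)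

lemma cube_avg_mono: "(\<And>A. A \<subseteq> V \<Longrightarrow> g A \<le> h A) \<Longrightarrow> cube_avg V g \<le> cube_avg V h"
  unfolding cube_avg_def by (intro divide_right_mono sum_mono) auto

lemma cube_avg_const: "finite V \<Longrightarrow> cube_avg V (\<lambda>A. c) = c"
  unfolding cube_avg_def by (simp add: card_Pow)

lemma cube_avg_add: "cube_avg V (\<lambda>A. g A + h A) = cube_avg V g + cube_avg V h"
  unfolding cube_avg_def by (simp add: sum.distrib add_divide_distrib)

lemma cube_avg_cmult: "cube_avg V (\<lambda>A. c * h A) = c * cube_avg V h"
  unfolding cube_avg_def by (simp flip: sum_distrib_left)

lemma cube_avg_sum: "cube_avg V (\<lambda>A. \<Sum>x\<in>X. h x A) = (\<Sum>x\<in>X. cube_avg V (h x))"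
  unfolding cube_avg_def by (subst sum.swap) (simp add: sum_divide_distrib)

lemma cube_avg_insert:
  assumes "finite V" "i \<notin> V"
  shows "cube_avg (insert i V) h = (cube_avg V h + cube_avg V (\<lambda>A. h (insert i A))) / 2"
proof -
  have "(\<Sum>A\<in>Pow (insert i V). h A) = (\<Sum>A\<in>Pow V. h A) + (\<Sum>A\<in>insert i ` Pow V. h A)"
    unfolding Pow_insert using assms by (intro sum.union_disjoint) auto
  also have "(\<Sum>A\<in>insert i ` Pow V. h A) = (\<Sum>A\<in>Pow V. h (insert i A))"
    using assms by (subst sum.reindex) (auto simp: inj_on_def)
  finally show ?thesis
    using assms by (simp add: cube_avg_def field_simps)
qed

lemma cube_avg_split:
  assumes "finite V" "i \<in> V"
  shows "cube_avg V h = cube_avg V (\<lambda>A. (h (insert i A) + h (A - {i})) / 2)"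
proof -
  obtain W where W: "V = insert i W" "i \<notin> W"
    using assms(2) by (meson mk_disjoint_insert)
  have "cube_avg W (\<lambda>A. (h (insert i A) + h (A - {i})) / 2)
      = cube_avg W (\<lambda>A. (1/2) * (h (insert i A) + h A))"
    by (rule cube_avg_cong) (use W in \<open>auto simp: subset_eq\<close>)
  then have *: "cube_avg W (\<lambda>A. (h (insert i A) + h (A - {i})) / 2)
      = (cube_avg W (\<lambda>A. h (insert i A)) + cube_avg W h) / 2"
    by (simp only: cube_avg_cmult cube_avg_add)
  have "cube_avg W (\<lambda>A. (h (insert i (insert i A)) + h (insert i A - {i})) / 2)
      = cube_avg W (\<lambda>A. (h (insert i A) + h (A - {i})) / 2)"
    by (rule cube_avg_cong) auto
  with * show ?thesis
    using assms(1) W by (simp add: cube_avg_insert)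
qed

lemma cube_avg_complement:
  assumes "finite V"
  shows "cube_avg V (\<lambda>A. h (V - A)) = cube_avg V h"
proof -
  have "bij_betw (\<lambda>A. V - A) (Pow V) (Pow V)"
    by (rule bij_betwI[where g = "\<lambda>A. V - A"]) auto
  then show ?thesis
    unfolding cube_avg_def by (simp add: sum.reindex_bij_betw)
qed

lemma cube_l2_norm_eq: "cube_l2_norm n g = sqrt (cube_avg {1..n} (\<lambda>A. (g A)\<^sup>2))"
  unfolding cube_l2_norm_def cube_avg_def
  by (subst integral_pmf_of_set) (auto simp: card_Pow)

section \<open>Signs and Walsh characters\<close>

definition cube_sign :: "nat \<Rightarrow> nat set \<Rightarrow> real" where
  "cube_sign i A = (if i \<in> A then -1 else 1)"

lemma cube_sign_square: "cube_sign i A * cube_sign i A = 1"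
  by (simp add: cube_sign_def)

lemma cube_avg_sign_mult:
  assumes "finite V" "i \<in> V"
  shows "cube_avg V (\<lambda>A. cube_sign i A * h A)
       = cube_avg V (\<lambda>A. (h (A - {i}) - h (insert i A)) / 2)"
  by (subst cube_avg_split[OF assms]) (simp add: cube_sign_def)

text \<open>Flipping \<open>i\<close> only reverses the sign of the integrand. This cancellation
  gives the orthogonality of both characters and martingale increments.\<close>

lemma cube_avg_sign_indep:
  assumes "finite V" "i \<in> V" "\<And>A. A \<subseteq> V \<Longrightarrow> h (insert i A) = h (A - {i})"
  shows "cube_avg V (\<lambda>A. cube_sign i A * h A) = 0"
proof -
  have "cube_avg V (\<lambda>A. cube_sign i A * h A) = cube_avg V (\<lambda>A. 0)"
    unfolding cube_avg_sign_mult[OF assms(1,2)]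
    by (rule cube_avg_cong) (simp add: assms(3))
  then show ?thesis using assms(1) by (simp add: cube_avg_const)
qed

definition walsh :: "nat set \<Rightarrow> nat set \<Rightarrow> real" where
  "walsh S A = (\<Prod>i\<in>S. cube_sign i A)"

lemma walsh_remove: "finite S \<Longrightarrow> i \<in> S \<Longrightarrow> walsh S A = cube_sign i A * walsh (S - {i}) A"
  unfolding walsh_def by (simp add: prod.remove)

lemma walsh_indep:
  assumes "i \<notin> S"
  shows "walsh S (insert i A) = walsh S A" "walsh S (A - {i}) = walsh S A"
  unfolding walsh_def using assms by (auto intro!: prod.cong simp: cube_sign_def)

lemma walsh_square: "walsh S A * walsh S A = 1"
  by (simp add: walsh_def cube_sign_square flip: prod.distrib)

lemma walsh_orthogonal:
  assumes V: "finite V" and "S \<subseteq> V" "T \<subseteq> V"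
  shows "cube_avg V (\<lambda>A. walsh S A * walsh T A) = of_bool (S = T)"
proof -
  have *: "cube_avg V (\<lambda>A. walsh S A * walsh T A) = 0"
    if "S \<subseteq> V" "T \<subseteq> V" "i \<in> S" "i \<notin> T" for S T i
  proof -
    have "finite S" using V that finite_subset by auto
    then have "cube_avg V (\<lambda>A. walsh S A * walsh T A)
        = cube_avg V (\<lambda>A. cube_sign i A * (walsh (S - {i}) A * walsh T A))"
      using that by (simp add: walsh_remove mult.assoc)
    also have "\<dots> = 0"
      by (rule cube_avg_sign_indep) (use that V in \<open>auto simp: walsh_indep\<close>)
    finally show ?thesis .
  qed
  consider "S = T" | i where "i \<in> S" "i \<notin> T" | i where "i \<in> T" "i \<notin> S" by blast
  then show ?thesis
  proof cases
    case 1 then show ?thesis by (simp add: walsh_square cube_avg_const V)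
  next
    case 2 then show ?thesis using *[of S T i] assms by auto
  next
    case 3 then show ?thesis using *[of T S i] assms by (auto simp: mult.commute)
  qed
qed

text \<open>The relabelling \<open>\<phi>\<close> serves derivatives, where the coefficient indexed
  by \<open>S\<close> sits on the character of a smaller set.\<close>

lemma walsh_parseval:
  assumes V: "finite V" and F: "finite F" and inj: "inj_on \<phi> F" and im: "\<phi> ` F \<subseteq> Pow V"
  shows "cube_avg V (\<lambda>A. (\<Sum>S\<in>F. c S * walsh (\<phi> S) A)\<^sup>2) = (\<Sum>S\<in>F. (c S)\<^sup>2)"
proof -
  have "cube_avg V (\<lambda>A. (\<Sum>S\<in>F. c S * walsh (\<phi> S) A)\<^sup>2)
      = cube_avg V (\<lambda>A. \<Sum>S\<in>F. \<Sum>T\<in>F. (c S * c T) * (walsh (\<phi> S) A * walsh (\<phi> T) A))"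
    by (simp add: power2_eq_square sum_product mult_ac)
  also have "\<dots> = (\<Sum>S\<in>F. \<Sum>T\<in>F. (c S * c T) * cube_avg V (\<lambda>A. walsh (\<phi> S) A * walsh (\<phi> T) A))"
    by (simp only: cube_avg_sum cube_avg_cmult)
  also have "\<dots> = (\<Sum>S\<in>F. \<Sum>T\<in>F. (c S * c T) * of_bool (S = T))"
    using V im inj by (intro sum.cong refl) (auto simp: walsh_orthogonal subset_eq inj_on_def)
  also have "\<dots> = (\<Sum>S\<in>F. (c S)\<^sup>2)"
    by (simp add: F of_bool_def power2_eq_square if_distrib[of "\<lambda>x. _ * x"] cong: if_cong)
  finally show ?thesis .
qed

lemma walsh_expansion:
  assumes "finite V"
  obtains c where "\<And>A. A \<subseteq> V \<Longrightarrow> f A = (\<Sum>S\<in>Pow V. c S * walsh S A)"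
proof -
  have "\<exists>c. \<forall>A\<subseteq>V. f A = (\<Sum>S\<in>Pow V. c S * walsh S A)"
    using assms
  proof (induction V arbitrary: f)
    case empty
    show ?case by (rule exI[of _ "\<lambda>S. f {}"]) (simp add: walsh_def)
  next
    case (insert i V)
    obtain c0 where c0: "\<forall>A\<subseteq>V. f A = (\<Sum>S\<in>Pow V. c0 S * walsh S A)"
      using insert.IH by blast
    obtain c1 where c1: "\<forall>A\<subseteq>V. f (insert i A) = (\<Sum>S\<in>Pow V. c1 S * walsh S A)"
      using insert.IH[of "\<lambda>A. f (insert i A)"] by blast
    \<comment> \<open>With s the sign of \<open>i\<close>, \<open>f\<close> is (1 + s)/2 times its
      restriction to \<open>i\<close> absent plus (1 - s)/2 times that to \<open>i\<close> present;
      \<open>c\<close> collects the coefficients of 1 and of s.\<close>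
    define c where "c S = (if i \<in> S then (c0 (S - {i}) - c1 (S - {i})) / 2
                                   else (c0 S + c1 S) / 2)" for S
    have "f A = (\<Sum>S\<in>Pow (insert i V). c S * walsh S A)" if A: "A \<subseteq> insert i V" for A
    proof -
      have "(\<Sum>S\<in>Pow (insert i V). c S * walsh S A)
          = (\<Sum>S\<in>Pow V. c S * walsh S A) + (\<Sum>S\<in>insert i ` Pow V. c S * walsh S A)"
        unfolding Pow_insert using insert.hyps by (intro sum.union_disjoint) auto
      also have "(\<Sum>S\<in>insert i ` Pow V. c S * walsh S A)
          = (\<Sum>S\<in>Pow V. c (insert i S) * walsh (insert i S) A)"
        using insert.hyps by (subst sum.reindex) (auto simp: inj_on_def)
      also have "(\<Sum>S\<in>Pow V. c S * walsh S A) + \<dots>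
          = (\<Sum>S\<in>Pow V. (c0 S + c1 S) / 2 * walsh S A
               + (c0 S - c1 S) / 2 * (cube_sign i A * walsh S A))"
        unfolding sum.distrib[symmetric]
      proof (intro sum.cong refl)
        fix S assume "S \<in> Pow V"
        then have S: "i \<notin> S" "finite S"
          using insert.hyps finite_subset by auto
        then have "walsh (insert i S) A = cube_sign i A * walsh S A"
          using walsh_remove[of "insert i S" i A] by simp
        then show "c S * walsh S A + c (insert i S) * walsh (insert i S) A
            = (c0 S + c1 S) / 2 * walsh S A + (c0 S - c1 S) / 2 * (cube_sign i A * walsh S A)"
          using S by (simp add: c_def)
      qed
      also have "\<dots> = f A"
      proof (cases "i \<in> A")
        case True
        have A': "A - {i} \<subseteq> V" using A by auto
        have "(\<Sum>S\<in>Pow V. (c0 S + c1 S) / 2 * walsh S A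
                 + (c0 S - c1 S) / 2 * (cube_sign i A * walsh S A))
            = (\<Sum>S\<in>Pow V. c1 S * walsh S (A - {i}))"
        proof (intro sum.cong refl)
          fix S assume "S \<in> Pow V"
          then have "walsh S (A - {i}) = walsh S A"
            using insert.hyps walsh_indep by blast
          then show "(c0 S + c1 S) / 2 * walsh S A
                 + (c0 S - c1 S) / 2 * (cube_sign i A * walsh S A) = c1 S * walsh S (A - {i})"
            using True by (simp add: cube_sign_def field_simps)
        qed
        also have "\<dots> = f A"
          using c1 A' True by (metis insert_Diff)
        finally show ?thesis .
      next
        case False
        then have "A \<subseteq> V" using A by auto
        then show ?thesis
          using c0 False by (auto intro!: sum.cong simp: cube_sign_def field_simps)
      qed
      finally show ?thesis by simp
    qed
    then show ?case by blast
  qed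
  then show ?thesis using that by blast
qed

text \<open>The discrete derivative in direction \<open>i\<close>. Removing \<open>i\<close> in the
  second term makes it constant along that direction, so iterated derivatives live on the whole
  cube.\<close>

definition marginal :: "(nat set \<Rightarrow> real) \<Rightarrow> nat \<Rightarrow> nat set \<Rightarrow> real" where
  "marginal f i A = f (insert i A) - f (A - {i})"

lemma marginal_marginal_same: "marginal (marginal f i) i A = 0"
  by (simp add: marginal_def)

lemma marginal_walsh_sum:
  "marginal (\<lambda>A. \<Sum>S\<in>F. c S * walsh (\<phi> S) A) i A = (\<Sum>S\<in>F. c S * marginal (walsh (\<phi> S)) i A)"
  by (simp add: marginal_def right_diff_distrib sum_subtractf)

lemma marginal_walsh:
  assumes "finite S"
  shows "marginal (walsh S) i A = (if i \<in> S then - 2 * walsh (S - {i}) A else 0)"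
  using assms by (auto simp: marginal_def walsh_remove walsh_indep cube_sign_def)

lemma marginal_commute:
  "i \<noteq> j \<Longrightarrow> marginal (marginal f i) j A = marginal (marginal f j) i A"
  by (simp add: marginal_def insert_commute insert_Diff_if Diff_insert[symmetric])

text \<open>Each derivative kills the characters without its index and turns the others into -2
  times the character with the index removed. Two of them leave \<open>4 * c S\<close> on distinct
  characters, and Parseval squares the 4.\<close>

lemma cube_avg_second_marginal:
  assumes V: "finite V" and c: "\<And>A. A \<subseteq> V \<Longrightarrow> f A = (\<Sum>S\<in>Pow V. c S * walsh S A)"
    and ij: "i \<in> V" "j \<in> V" "i \<noteq> j"
  shows "cube_avg V (\<lambda>A. (marginal (marginal f i) j A)\<^sup>2)
       = 16 * (\<Sum>S | S \<subseteq> V \<and> i \<in> S \<and> j \<in> S. (c S)\<^sup>2)"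
proof -
  let ?F = "{S. S \<subseteq> V \<and> i \<in> S \<and> j \<in> S}"
  have fin: "finite S" if "S \<subseteq> V" for S using V that finite_subset by auto
  have 1: "marginal f i A = (\<Sum>S\<in>Pow V. c S * marginal (walsh S) i A)" if "A \<subseteq> V" for A
  proof -
    have "marginal f i A = marginal (\<lambda>A. \<Sum>S\<in>Pow V. c S * walsh S A) i A"
      using that ij unfolding marginal_def by (subst (1 2) c) auto
    then show ?thesis by (simp add: marginal_walsh_sum[where \<phi> = "\<lambda>S. S"])
  qed
  have 2: "marginal (marginal f i) j A = (\<Sum>S\<in>?F. (4 * c S) * walsh (S - {i} - {j}) A)"
    if "A \<subseteq> V" for A
  proof -
    have "marginal (marginal f i) j A
        = (\<Sum>S\<in>Pow V. c S * marginal (walsh S) i (insert j A))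
          - (\<Sum>S\<in>Pow V. c S * marginal (walsh S) i (A - {j}))"
      using that ij unfolding marginal_def[of "marginal f i"] by (subst (1 2) 1) auto
    also have "\<dots> = (\<Sum>S\<in>Pow V. c S * marginal (marginal (walsh S) i) j A)"
      by (simp add: marginal_def[of "marginal _ i"] right_diff_distrib sum_subtractf)
    also have "\<dots> = (\<Sum>S\<in>Pow V. if i \<in> S \<and> j \<in> S
                          then (4 * c S) * walsh (S - {i} - {j}) A else 0)"
    proof (intro sum.cong refl)
      fix S assume "S \<in> Pow V"
      then have S: "finite S" using fin by auto
      have "marginal (walsh S) i = (\<lambda>A. if i \<in> S then -2 * walsh (S - {i}) A else 0)"
        using S by (simp add: fun_eq_iff marginal_walsh)
      then have "marginal (marginal (walsh S) i) j A
          = (if i \<in> S then -2 * marginal (walsh (S - {i})) j A else 0)"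
        by (simp add: marginal_def)
      also have "\<dots> = (if i \<in> S \<and> j \<in> S then 4 * walsh (S - {i} - {j}) A else 0)"
        using S ij by (auto simp: marginal_walsh)
      finally show "c S * marginal (marginal (walsh S) i) j A
          = (if i \<in> S \<and> j \<in> S then (4 * c S) * walsh (S - {i} - {j}) A else 0)" by simp
    qed
    also have "\<dots> = (\<Sum>S\<in>?F. (4 * c S) * walsh (S - {i} - {j}) A)"
      using V by (intro sum.mono_neutral_cong_right) auto
    finally show ?thesis .
  qed
  have "cube_avg V (\<lambda>A. (marginal (marginal f i) j A)\<^sup>2)
      = cube_avg V (\<lambda>A. (\<Sum>S\<in>?F. (4 * c S) * walsh (S - {i} - {j}) A)\<^sup>2)"
    by (rule cube_avg_cong) (simp only: 2)
  also have "\<dots> = (\<Sum>S\<in>?F. (4 * c S)\<^sup>2)"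
  proof (rule walsh_parseval[OF V])
    show "inj_on (\<lambda>S. S - {i} - {j}) ?F"
      by (rule inj_onI) blast
  qed (use V in auto)
  finally show ?thesis by (simp add: power_mult_distrib sum_distrib_left)
qed

subsection \<open>Low-degree functions\<close>

text \<open>Multilinear polynomials as functions: \<open>of_bool (S \<subseteq> A)\<close> is the
  product of the variables in \<open>S\<close> at the point \<open>A\<close>. Closure properties
  then follow by rule induction, and formal polynomials enter only in
  \<open>lowdeg_imp_mpoly\<close>.\<close>

inductive lowdeg :: "nat set \<Rightarrow> nat \<Rightarrow> (nat set \<Rightarrow> real) \<Rightarrow> bool" for V d where
  lowdeg_monomial: "S \<subseteq> V \<Longrightarrow> card S \<le> d \<Longrightarrow> lowdeg V d (\<lambda>A. c * of_bool (S \<subseteq> A))"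
| lowdeg_add: "lowdeg V d g \<Longrightarrow> lowdeg V d h \<Longrightarrow> lowdeg V d (\<lambda>A. g A + h A)"

lemma lowdeg_const: "lowdeg V d (\<lambda>A. c)"
  using lowdeg_monomial[of "{}" V d c] by simp

lemma lowdeg_scale: "lowdeg V d h \<Longrightarrow> lowdeg V d (\<lambda>A. c * h A)"
proof (induction rule: lowdeg.induct)
  case (lowdeg_monomial S b)
  then show ?case using lowdeg.lowdeg_monomial[of S V d "c * b"] by (simp add: mult.assoc)
next
  case (lowdeg_add g h)
  then show ?case using lowdeg.lowdeg_add by (simp add: distrib_left)
qed

lemma lowdeg_sum:
  assumes "finite X" "\<And>x. x \<in> X \<Longrightarrow> lowdeg V d (h x)"
  shows "lowdeg V d (\<lambda>A. \<Sum>x\<in>X. h x A)"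
  using assms
proof (induction X)
  case empty
  show ?case using lowdeg_const[of V d 0] by simp
next
  case (insert x X)
  then show ?case using lowdeg_add by simp
qed

lemma lowdeg_mono: "lowdeg V d h \<Longrightarrow> V \<subseteq> W \<Longrightarrow> d \<le> e \<Longrightarrow> lowdeg W e h"
proof (induction rule: lowdeg.induct)
  case (lowdeg_monomial S c)
  then show ?case by (intro lowdeg.lowdeg_monomial) auto
next
  case (lowdeg_add g h)
  then show ?case by (intro lowdeg.lowdeg_add) auto
qed

lemma lowdeg_mult_var:
  assumes "lowdeg V d h" "i \<in> V"
  shows "lowdeg V (Suc d) (\<lambda>A. of_bool (i \<in> A) * h A)"
  using assms(1)
proof (induction rule: lowdeg.induct)
  case (lowdeg_monomial S c)
  have "card (insert i S) \<le> Suc d"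
    using lowdeg_monomial by (cases "finite S") (auto simp: card_insert_if)
  then have "lowdeg V (Suc d) (\<lambda>A. c * of_bool (insert i S \<subseteq> A))"
    using lowdeg_monomial assms by (intro lowdeg.lowdeg_monomial) auto
  then show ?case by (simp add: of_bool_conj mult_ac)
next
  case (lowdeg_add g h)
  then show ?case using lowdeg.lowdeg_add by (simp add: distrib_left)
qed

lemma lowdeg_indep:
  assumes "lowdeg V d h" "i \<notin> V"
  shows "h (insert i A) = h A \<and> h (A - {i}) = h A"
  using assms(1)
proof (induction rule: lowdeg.induct)
  case (lowdeg_monomial S c)
  then have "i \<notin> S" using assms(2) by auto
  then have "S \<subseteq> insert i A \<longleftrightarrow> S \<subseteq> A" "S \<subseteq> A - {i} \<longleftrightarrow> S \<subseteq> A" by auto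
  then show ?case by simp
qed simp

text \<open>A query of coordinate \<open>i\<close> costs one degree: the branching function is g + x
  (h - g), with x the variable of index \<open>i\<close>.\<close>

lemma lowdeg_branch:
  assumes "lowdeg V d g" "lowdeg V d h"
  shows "lowdeg (insert i V) (Suc d) (\<lambda>A. if i \<in> A then h A else g A)"
proof -
  have *: "lowdeg (insert i V) d g" "lowdeg (insert i V) d h"
    using assms by (auto intro: lowdeg_mono)
  have diff: "lowdeg (insert i V) d (\<lambda>A. h A + (-1) * g A)"
    by (rule lowdeg_add[OF *(2) lowdeg_scale[OF *(1)]])
  have g: "lowdeg (insert i V) (Suc d) g"
    by (rule lowdeg_mono[OF *(1)]) auto
  have "lowdeg (insert i V) (Suc d) (\<lambda>A. g A + of_bool (i \<in> A) * (h A + (-1) * g A))"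
    by (rule lowdeg_add[OF g lowdeg_mult_var[OF diff insertI1]])
  also have "(\<lambda>A. g A + of_bool (i \<in> A) * (h A + (-1) * g A)) = (\<lambda>A. if i \<in> A then h A else g A)"
    by auto
  finally show ?thesis .
qed

lemma lowdeg_walsh:
  assumes "finite S" "S \<subseteq> V" "card S \<le> d"
  shows "lowdeg V d (walsh S)"
proof -
  have "lowdeg V (card S) (walsh S)"
    using assms(1,2)
  proof (induction S)
    case empty
    show ?case using lowdeg_const[of V 0 1] by (simp add: walsh_def[abs_def])
  next
    case (insert i S)
    then have S: "lowdeg V (card S) (walsh S)" by simp
    have "lowdeg V (Suc (card S)) (\<lambda>A. walsh S A + (-2) * (of_bool (i \<in> A) * walsh S A))"
      using insert by (intro lowdeg_add lowdeg_scale lowdeg_mult_var lowdeg_mono[OF S]) auto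
    also have "(\<lambda>A. walsh S A + (-2) * (of_bool (i \<in> A) * walsh S A)) = walsh (insert i S)"
      using insert by (auto simp: fun_eq_iff walsh_def cube_sign_def)
    finally show ?case using insert by simp
  qed
  then show ?thesis using assms by (auto intro: lowdeg_mono)
qed

lemma lowdeg_avoid:
  assumes "finite S" "S \<subseteq> V"
  shows "lowdeg V (card S) (\<lambda>A. of_bool (S \<inter> A = {}))"
  using assms
proof (induction S)
  case empty
  show ?case using lowdeg_const[of V 0 1] by simp
next
  case (insert i S)
  then have S: "lowdeg V (card S) (\<lambda>A. of_bool (S \<inter> A = {}))" by simp
  have "lowdeg V (Suc (card S))
      (\<lambda>A. of_bool (S \<inter> A = {}) + (-1) * (of_bool (i \<in> A) * of_bool (S \<inter> A = {})))"
    using insert by (intro lowdeg_add lowdeg_scale lowdeg_mult_var lowdeg_mono[OF S]) auto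
  also have "(\<lambda>A. of_bool (S \<inter> A = {}) + (-1) * (of_bool (i \<in> A) * of_bool (S \<inter> A = {})))
      = (\<lambda>A. of_bool (insert i S \<inter> A = {}) :: real)"
    by (auto simp: fun_eq_iff)
  finally show ?case using insert by simp
qed

text \<open>Substituting 1 - x for every variable keeps the degree; a monomial becomes a product of
  such factors, which \<open>lowdeg_avoid\<close> covers.\<close>

lemma lowdeg_complement:
  assumes "lowdeg V d h" "finite V"
  shows "\<exists>h'. lowdeg V d h' \<and> (\<forall>A\<subseteq>V. h' A = h (V - A))"
  using assms(1)
proof (induction rule: lowdeg.induct)
  case (lowdeg_monomial S c)
  have "finite S" using lowdeg_monomial assms(2) finite_subset by auto
  then have "lowdeg V d (\<lambda>A. c * of_bool (S \<inter> A = {}))"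
    using lowdeg_monomial by (intro lowdeg_scale lowdeg_mono[OF lowdeg_avoid[of S V]]) auto
  moreover have "S \<inter> A = {} \<longleftrightarrow> S \<subseteq> V - A" for A using lowdeg_monomial by auto
  ultimately have "lowdeg V d (\<lambda>A. c * of_bool (S \<subseteq> V - A))" by simp
  then show ?case by blast
next
  case (lowdeg_add g h)
  then obtain g' h' where "lowdeg V d g'" "lowdeg V d h'"
    "\<forall>A\<subseteq>V. g' A = g (V - A)" "\<forall>A\<subseteq>V. h' A = h (V - A)" by blast
  then show ?case by (intro exI[of _ "\<lambda>A. g' A + h' A"]) (auto intro: lowdeg.intros)
qed

text \<open>On the right, \<open>(c S)\<^sup>2\<close> has weight 16 times the number of ordered
  pairs of distinct indices in \<open>S\<close>. The sets discarded by the truncation have at least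
  d + 1 elements, hence at least (d + 1) d such pairs.\<close>

lemma walsh_truncation:
  assumes V: "finite V"
  shows "\<exists>h. lowdeg V d h \<and>
    16 * (real d)\<^sup>2 * cube_avg V (\<lambda>A. (f A - h A)\<^sup>2)
      \<le> (\<Sum>i\<in>V. \<Sum>j\<in>V. cube_avg V (\<lambda>A. (marginal (marginal f i) j A)\<^sup>2))"
proof -
  obtain c where c: "\<And>A. A \<subseteq> V \<Longrightarrow> f A = (\<Sum>S\<in>Pow V. c S * walsh S A)"
    using walsh_expansion[OF V] by blast
  let ?L = "{S\<in>Pow V. card S \<le> d}" and ?H = "{S\<in>Pow V. \<not> card S \<le> d}"
  define h where "h A = (\<Sum>S\<in>?L. c S * walsh S A)" for A
  have fin: "finite S" if "S \<subseteq> V" for S using V that finite_subset by auto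
  have h: "lowdeg V d h"
    unfolding h_def using V fin by (intro lowdeg_sum lowdeg_scale lowdeg_walsh) auto
  have "f A - h A = (\<Sum>S\<in>?H. c S * walsh S A)" if "A \<subseteq> V" for A
    using sum.Int_Diff[of "Pow V" "\<lambda>S. c S * walsh S A" "{S. card S \<le> d}"] V that
    by (simp add: h_def c Int_def set_diff_eq)
  then have "cube_avg V (\<lambda>A. (f A - h A)\<^sup>2) = cube_avg V (\<lambda>A. (\<Sum>S\<in>?H. c S * walsh S A)\<^sup>2)"
    by (intro cube_avg_cong) simp
  also have "\<dots> = (\<Sum>S\<in>?H. (c S)\<^sup>2)"
    using walsh_parseval[OF V, of ?H "\<lambda>S. S" c] V by auto
  finally have err: "cube_avg V (\<lambda>A. (f A - h A)\<^sup>2) = (\<Sum>S\<in>?H. (c S)\<^sup>2)" .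
  have pairs: "(\<Sum>i\<in>V. \<Sum>j\<in>V. of_bool (i \<noteq> j \<and> i \<in> S \<and> j \<in> S)) = real (card S * (card S - 1))"
    if "S \<subseteq> V" for S
  proof -
    have "(\<Sum>j\<in>V. of_bool (i \<noteq> j \<and> i \<in> S \<and> j \<in> S)) = of_bool (i \<in> S) * real (card S - 1)" for i
    proof -
      have "V \<inter> {j. i \<noteq> j \<and> i \<in> S \<and> j \<in> S} = (if i \<in> S then S - {i} else {})"
        using that by auto
      then show ?thesis using V that by (simp add: of_bool_def sum.If_cases)
    qed
    moreover have "V \<inter> S = S" using that by auto
    ultimately show ?thesis
      using V by (simp add: of_bool_def sum.If_cases flip: sum_distrib_right)
  qed
  have "(\<Sum>i\<in>V. \<Sum>j\<in>V. cube_avg V (\<lambda>A. (marginal (marginal f i) j A)\<^sup>2))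
      = (\<Sum>i\<in>V. \<Sum>j\<in>V. \<Sum>S\<in>Pow V. 16 * (c S)\<^sup>2 * of_bool (i \<noteq> j \<and> i \<in> S \<and> j \<in> S))"
  proof (intro sum.cong refl)
    fix i j assume ij: "i \<in> V" "j \<in> V"
    show "cube_avg V (\<lambda>A. (marginal (marginal f i) j A)\<^sup>2)
      = (\<Sum>S\<in>Pow V. 16 * (c S)\<^sup>2 * of_bool (i \<noteq> j \<and> i \<in> S \<and> j \<in> S))"
    proof (cases "i = j")
      case True
      then show ?thesis using V by (simp add: marginal_marginal_same cube_avg_const)
    next
      case False
      have "cube_avg V (\<lambda>A. (marginal (marginal f i) j A)\<^sup>2)
          = (\<Sum>S | S \<subseteq> V \<and> i \<in> S \<and> j \<in> S. 16 * (c S)\<^sup>2)"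
        by (simp add: cube_avg_second_marginal[OF V c ij False] sum_distrib_left)
      also have "\<dots> = (\<Sum>S\<in>Pow V. 16 * (c S)\<^sup>2 * of_bool (i \<noteq> j \<and> i \<in> S \<and> j \<in> S))"
        using V False by (intro sum.mono_neutral_cong_left) auto
      finally show ?thesis .
    qed
  qed
  also have "\<dots> = (\<Sum>S\<in>Pow V. \<Sum>i\<in>V. \<Sum>j\<in>V. 16 * (c S)\<^sup>2 * of_bool (i \<noteq> j \<and> i \<in> S \<and> j \<in> S))"
    by (simp only: sum.swap[of _ "Pow V" V])
  also have "\<dots> = (\<Sum>S\<in>Pow V. 16 * (c S)\<^sup>2 * real (card S * (card S - 1)))"
    by (intro sum.cong refl) (simp add: pairs flip: sum_distrib_left)
  also have "\<dots> \<ge> (\<Sum>S\<in>?H. 16 * (c S)\<^sup>2 * real (card S * (card S - 1)))"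
    using V by (intro sum_mono2) auto
  also have "(\<Sum>S\<in>?H. 16 * (c S)\<^sup>2 * real (card S * (card S - 1))) \<ge> (\<Sum>S\<in>?H. 16 * (c S)\<^sup>2 * (real d)\<^sup>2)"
  proof (intro sum_mono mult_left_mono)
    fix S assume "S \<in> ?H"
    then have "d * d \<le> card S * (card S - 1)" by (intro mult_le_mono) auto
    then show "(real d)\<^sup>2 \<le> real (card S * (card S - 1))"
      by (simp only: power2_eq_square of_nat_mult[symmetric] of_nat_le_iff)
  qed auto
  also have "(\<Sum>S\<in>?H. 16 * (c S)\<^sup>2 * (real d)\<^sup>2) = 16 * (real d)\<^sup>2 * cube_avg V (\<lambda>A. (f A - h A)\<^sup>2)"
    by (simp add: err sum_distrib_left mult_ac)
  finally show ?thesis using h by blast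
qed

section \<open>From low-degree functions to formal polynomials\<close>

definition monomial :: "nat set \<Rightarrow> nat \<Rightarrow>\<^sub>0 nat" where
  "monomial S = (\<Sum>i\<in>S. Poly_Mapping.single i 1)"

lemma lookup_monomial: "finite S \<Longrightarrow> Poly_Mapping.lookup (monomial S) i = of_bool (i \<in> S)"
  by (simp add: monomial_def lookup_sum lookup_single when_def)

lemma keys_monomial: "finite S \<Longrightarrow> Poly_Mapping.keys (monomial S) = S"
  by (auto simp: in_keys_iff lookup_monomial)

lemma mpoly_degree_le_iff:
  "mpoly_degree p \<le> d \<longleftrightarrow>
     (\<forall>m\<in>Poly_Mapping.keys p. (\<Sum>i\<in>Poly_Mapping.keys m. Poly_Mapping.lookup m i) \<le> d)"
  by (simp add: mpoly_degree_def)

lemma mpoly_eval_superset: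
  assumes "finite K" "Poly_Mapping.keys p \<subseteq> K"
  shows "mpoly_eval p x = (\<Sum>m\<in>K. Poly_Mapping.lookup p m *
           (\<Prod>i\<in>Poly_Mapping.keys m. x i ^ Poly_Mapping.lookup m i))"
  unfolding mpoly_eval_def using assms
  by (intro sum.mono_neutral_left) (auto simp: in_keys_iff)

lemma mpoly_eval_add: "mpoly_eval (p + q) x = mpoly_eval p x + mpoly_eval q x"
proof -
  let ?K = "Poly_Mapping.keys p \<union> Poly_Mapping.keys q"
  have K: "finite ?K" by simp
  show ?thesis
    using Poly_Mapping.keys_add[of p q]
    by (simp add: mpoly_eval_superset[OF K] lookup_add distrib_right sum.distrib)
qed

lemma lowdeg_imp_mpoly:
  assumes "lowdeg V d h" "finite V"
  shows "\<exists>p. mpoly_vars p \<subseteq> V \<and> mpoly_degree p \<le> d \<and> (\<forall>A. mpoly_eval p (indicator A) = h A)"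
  using assms(1)
proof (induction rule: lowdeg.induct)
  case (lowdeg_monomial S c)
  let ?p = "Poly_Mapping.single (monomial S) c"
  have S: "finite S" using lowdeg_monomial assms(2) finite_subset by auto
  have "mpoly_eval ?p (indicator A) = c * of_bool (S \<subseteq> A)" for A
    using S by (subst mpoly_eval_superset[of "{monomial S}"])
      (auto simp: keys_monomial lookup_monomial indicator_def subset_iff intro!: prod.neutral)
  moreover have "mpoly_vars ?p \<subseteq> V"
    using S lowdeg_monomial by (auto simp: mpoly_vars_def keys_monomial split: if_splits)
  moreover have "mpoly_degree ?p \<le> d"
    using S lowdeg_monomial by (auto simp: mpoly_degree_le_iff keys_monomial lookup_monomial split: if_splits)
  ultimately show ?case by blast
next
  case (lowdeg_add g h)
  then obtain p q where
    p: "mpoly_vars p \<subseteq> V" "mpoly_degree p \<le> d" "\<forall>A. mpoly_eval p (indicator A) = g A" and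
    q: "mpoly_vars q \<subseteq> V" "mpoly_degree q \<le> d" "\<forall>A. mpoly_eval q (indicator A) = h A" by blast
  have "mpoly_vars (p + q) \<subseteq> V" "mpoly_degree (p + q) \<le> d"
    using p(1,2) q(1,2) Poly_Mapping.keys_add[of p q]
    unfolding mpoly_vars_def mpoly_degree_le_iff by blast+
  then show ?case using p(3) q(3) by (intro exI[of _ "p + q"]) (simp add: mpoly_eval_add)
qed

subsection \<open>Second derivatives of Lipschitz submodular functions\<close>

text \<open>Diminishing returns: submodularity for \<open>A\<close> with \<open>i\<close> added and
  \<open>B\<close> with \<open>i\<close> removed.\<close>

lemma marginal_antimono:
  assumes "submodular_on V f" "A \<subseteq> B" "B \<subseteq> V" "i \<in> V"
  shows "marginal f i B \<le> marginal f i A"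
proof -
  have "f (insert i (A - {i}) \<union> (B - {i})) + f (insert i (A - {i}) \<inter> (B - {i}))
      \<le> f (insert i (A - {i})) + f (B - {i})"
    using assms by (intro assms(1)[unfolded submodular_on_def, rule_format]) auto
  moreover have "insert i (A - {i}) \<union> (B - {i}) = insert i B"
    "insert i (A - {i}) \<inter> (B - {i}) = A - {i}" using assms(2) by auto
  ultimately show ?thesis by (simp add: marginal_def)
qed

text \<open>The sign reversal lets bounds on positive marginals be reused for negative ones, by
  applying them to the complemented function.\<close>

lemma marginal_complement:
  assumes "i \<in> V" "A \<subseteq> V"
  shows "marginal (\<lambda>A. f (V - A)) i A = - marginal f i (V - A)"
proof -
  have "V - (A - {i}) = insert i (V - A)" "V - insert i A = V - A - {i}" using assms by auto
  then show ?thesis by (simp add: marginal_def)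
qed

lemma submodular_on_complement:
  assumes "submodular_on V f"
  shows "submodular_on V (\<lambda>A. f (V - A))"
  unfolding submodular_on_def
proof (intro allI impI)
  fix A B assume "A \<subseteq> V" "B \<subseteq> V"
  have "f ((V - A) \<union> (V - B)) + f ((V - A) \<inter> (V - B)) \<le> f (V - A) + f (V - B)"
    by (intro assms[unfolded submodular_on_def, rule_format]) auto
  then show "f (V - (A \<union> B)) + f (V - A \<inter> B) \<le> f (V - A) + f (V - B)"
    by (simp add: Diff_Un Diff_Int)
qed

text \<open>Build \<open>T\<close> in increasing order. The true increment at \<open>j\<close> is
  the marginal at \<open>T \<inter> {..<j}\<close>, a subset of \<open>A \<inter> {..<j}\<close>, so
  it dominates the summand by diminishing returns; the true increments telescope.\<close>

lemma submodular_chain: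
  assumes f: "submodular_on V f" and V: "finite V" and "T \<subseteq> A" "A \<subseteq> V"
  shows "(\<Sum>j\<in>T. marginal f j (A \<inter> {..<j})) \<le> f T - f {}"
proof -
  have "finite T" using assms(2-4) by (meson finite_subset)
  then show ?thesis using \<open>T \<subseteq> A\<close>
  proof (induction T rule: finite_linorder_max_induct)
    case empty
    show ?case by simp
  next
    case (insert b T)
    then have b: "b \<notin> T" "T \<subseteq> A \<inter> {..<b}" by auto
    have "marginal f b (A \<inter> {..<b}) \<le> marginal f b T"
      using insert b \<open>A \<subseteq> V\<close> by (intro marginal_antimono[OF f]) auto
    also have "\<dots> = f (insert b T) - f T" using b by (simp add: marginal_def)
    finally show ?case using insert b by simp
  qed
qed

section \<open>Positive gains when coordinates are revealed in increasing order\<close>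

definition pos_marginal :: "(nat set \<Rightarrow> real) \<Rightarrow> nat \<Rightarrow> nat set \<Rightarrow> real" where
  "pos_marginal f j A = max 0 (marginal f j A)"

text \<open>Only coordinates below \<open>j\<close> enter, so the products
  \<open>cube_sign j A * gain f j A\<close> are martingale differences.\<close>

definition gain :: "(nat set \<Rightarrow> real) \<Rightarrow> nat \<Rightarrow> nat set \<Rightarrow> real" where
  "gain f j A = pos_marginal f j (A \<inter> {..<j})"

lemma gain_nonneg: "0 \<le> gain f j A"
  by (simp add: gain_def pos_marginal_def)

lemma gain_indep:
  assumes "j \<le> k"
  shows "gain f j (insert k A) = gain f j A" "gain f j (A - {k}) = gain f j A"
proof -
  have "insert k A \<inter> {..<j} = A \<inter> {..<j}" "(A - {k}) \<inter> {..<j} = A \<inter> {..<j}"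
    using assms by auto
  then show "gain f j (insert k A) = gain f j A" "gain f j (A - {k}) = gain f j A"
    by (simp_all add: gain_def)
qed

lemma pos_marginal_le_gain:
  assumes "submodular_on V f" "A \<subseteq> V" "j \<in> V"
  shows "pos_marginal f j A \<le> gain f j A"
  using marginal_antimono[OF assms(1), of "A \<inter> {..<j}" A j] assms
  by (auto simp: gain_def pos_marginal_def)

text \<open>Dropping the zero gains leaves a subset \<open>T\<close> of \<open>A\<close> to which
  the chain bound applies, and \<open>f T - f {}\<close> is at most 1.\<close>

lemma gain_sum_le:
  assumes f: "submodular_on V f" and V: "finite V" and A: "A \<subseteq> V"
    and range: "\<And>A. A \<subseteq> V \<Longrightarrow> 0 \<le> f A \<and> f A \<le> 1"
  shows "(\<Sum>j\<in>A. gain f j A) \<le> 1"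
proof -
  define T where "T = {j\<in>A. 0 < marginal f j (A \<inter> {..<j})}"
  have "finite A" using A V finite_subset by blast
  then have "(\<Sum>j\<in>A. gain f j A) = (\<Sum>j\<in>T. marginal f j (A \<inter> {..<j}))"
    by (intro sum.mono_neutral_cong_right) (auto simp: T_def gain_def pos_marginal_def)
  also have "\<dots> \<le> f T - f {}"
    by (rule submodular_chain[OF f V _ A]) (auto simp: T_def)
  also have "T \<subseteq> V" using A by (auto simp: T_def)
  then have "f T - f {} \<le> 1" using range[of T] range[of "{}"] by auto
  finally show ?thesis .
qed

text \<open>Martingale differences are orthogonal: for \<open>j < k\<close>, every factor except
  \<open>cube_sign k A\<close> is independent of coordinate \<open>k\<close>.\<close>

lemma gain_martingale_square:
  assumes V: "finite V"
  shows "cube_avg V (\<lambda>A. (\<Sum>j\<in>V. cube_sign j A * gain f j A)\<^sup>2)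
       = (\<Sum>j\<in>V. cube_avg V (\<lambda>A. (gain f j A)\<^sup>2))"
proof -
  have cross: "cube_avg V (\<lambda>A. (cube_sign j A * gain f j A) * (cube_sign k A * gain f k A)) = 0"
    if "j \<in> V" "k \<in> V" "j < k" for j k
  proof -
    have "cube_avg V (\<lambda>A. cube_sign k A * (cube_sign j A * gain f j A * gain f k A)) = 0"
      using that V
      by (intro cube_avg_sign_indep) (auto simp: gain_indep cube_sign_def)
    then show ?thesis by (simp add: mult_ac)
  qed
  have "cube_avg V (\<lambda>A. (\<Sum>j\<in>V. cube_sign j A * gain f j A)\<^sup>2)
      = (\<Sum>j\<in>V. \<Sum>k\<in>V. cube_avg V (\<lambda>A. (cube_sign j A * gain f j A) * (cube_sign k A * gain f k A)))"
    by (simp only: power2_eq_square sum_product cube_avg_sum)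
  also have "\<dots> = (\<Sum>j\<in>V. \<Sum>k\<in>V. if j = k then cube_avg V (\<lambda>A. (gain f j A)\<^sup>2) else 0)"
  proof (intro sum.cong refl)
    fix j k assume jk: "j \<in> V" "k \<in> V"
    show "cube_avg V (\<lambda>A. (cube_sign j A * gain f j A) * (cube_sign k A * gain f k A))
        = (if j = k then cube_avg V (\<lambda>A. (gain f j A)\<^sup>2) else 0)"
    proof (cases j k rule: linorder_cases)
      case less
      then show ?thesis using cross[OF jk] by simp
    next
      case equal
      have "(cube_sign j A * gain f j A) * (cube_sign j A * gain f j A) = (gain f j A)\<^sup>2" for A
        by (simp add: cube_sign_def power2_eq_square)
      then show ?thesis using equal by simp
    next
      case greater
      then show ?thesis using cross[OF jk(2,1)] by (subst mult.commute) simp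
    qed
  qed
  also have "\<dots> = (\<Sum>j\<in>V. cube_avg V (\<lambda>A. (gain f j A)\<^sup>2))"
    using V by simp
  finally show ?thesis .
qed

section \<open>Moment bounds under a Lipschitz condition\<close>

locale lipschitz_submodular =
  fixes V :: "nat set" and f :: "nat set \<Rightarrow> real" and \<alpha> :: real
  assumes finite_V: "finite V"
    and submodular: "submodular_on V f"
    and range: "\<And>A. A \<subseteq> V \<Longrightarrow> 0 \<le> f A \<and> f A \<le> 1"
    and marginal_bound: "\<And>A i. A \<subseteq> V \<Longrightarrow> i \<in> V \<Longrightarrow> \<bar>marginal f i A\<bar> \<le> \<alpha>"
    and alpha: "0 < \<alpha>" "\<alpha> \<le> 1"
begin

lemma gain_le: "A \<subseteq> V \<Longrightarrow> j \<in> V \<Longrightarrow> gain f j A \<le> \<alpha>"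
  using marginal_bound[OF le_infI1, of A j "{..<j}"] alpha by (auto simp: gain_def pos_marginal_def)

text \<open>Since \<open>1 = 2 * of_bool (j \<in> A) + cube_sign j A\<close>, the full sum splits
  into a part controlled by \<open>gain_sum_le\<close> and a martingale.\<close>

lemma gain_sum_eq:
  assumes "A \<subseteq> V"
  shows "(\<Sum>j\<in>V. gain f j A) = 2 * (\<Sum>j\<in>A. gain f j A) + (\<Sum>j\<in>V. cube_sign j A * gain f j A)"
proof -
  have "(\<Sum>j\<in>A. gain f j A) = (\<Sum>j\<in>V. if j \<in> A then gain f j A else 0)"
    using finite_V assms by (intro sum.mono_neutral_cong_left) auto
  then show ?thesis
    by (simp add: sum_distrib_left flip: sum.distrib)
       (auto intro!: sum.cong simp: cube_sign_def)
qed

text \<open>One factor of each square is at most \<alpha>; in the remaining sum the martingale has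
  mean zero and the other part is at most 2.\<close>

lemma gain_square_sum: "(\<Sum>j\<in>V. cube_avg V (\<lambda>A. (gain f j A)\<^sup>2)) \<le> 2 * \<alpha>"
proof -
  have "(\<Sum>j\<in>V. cube_avg V (\<lambda>A. (gain f j A)\<^sup>2)) \<le> (\<Sum>j\<in>V. cube_avg V (\<lambda>A. \<alpha> * gain f j A))"
    unfolding power2_eq_square
    by (intro sum_mono cube_avg_mono mult_right_mono gain_le gain_nonneg)
  also have "\<dots> = \<alpha> * cube_avg V (\<lambda>A. \<Sum>j\<in>V. gain f j A)"
    by (simp only: cube_avg_cmult cube_avg_sum sum_distrib_left)
  also have "cube_avg V (\<lambda>A. \<Sum>j\<in>V. gain f j A)
      = cube_avg V (\<lambda>A. 2 * (\<Sum>j\<in>A. gain f j A) + (\<Sum>j\<in>V. cube_sign j A * gain f j A))"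
    by (rule cube_avg_cong) (rule gain_sum_eq)
  also have "\<dots> = cube_avg V (\<lambda>A. 2 * (\<Sum>j\<in>A. gain f j A))
      + (\<Sum>j\<in>V. cube_avg V (\<lambda>A. cube_sign j A * gain f j A))"
    by (simp only: cube_avg_add cube_avg_sum)
  also have "(\<Sum>j\<in>V. cube_avg V (\<lambda>A. cube_sign j A * gain f j A)) = 0"
    by (intro sum.neutral ballI cube_avg_sign_indep finite_V) (auto simp: gain_indep)
  also have "cube_avg V (\<lambda>A. 2 * (\<Sum>j\<in>A. gain f j A)) \<le> cube_avg V (\<lambda>A. 2)"
    by (rule cube_avg_mono) (use gain_sum_le[OF submodular finite_V _ range] in force)
  finally show ?thesis
    using alpha finite_V by (simp add: cube_avg_const mult.commute)
qed

text \<open>With s the sum over \<open>A\<close> and M the martingale, (2s + M)^2 is at most 8 s^2 +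
  2 M^2. As s is at most 1 and M^2 has mean at most 2, this gives 8 + 4.\<close>

lemma gain_total_square: "cube_avg V (\<lambda>A. (\<Sum>j\<in>V. gain f j A)\<^sup>2) \<le> 12"
proof -
  let ?M = "\<lambda>A. \<Sum>j\<in>V. cube_sign j A * gain f j A"
  have "(\<Sum>j\<in>V. gain f j A)\<^sup>2 \<le> 8 + 2 * (?M A)\<^sup>2" if A: "A \<subseteq> V" for A
  proof -
    let ?s = "\<Sum>j\<in>A. gain f j A"
    have s: "0 \<le> ?s" "?s \<le> 1"
      using gain_sum_le[OF submodular finite_V A range] by (auto intro: sum_nonneg gain_nonneg)
    then have "?s\<^sup>2 \<le> 1" by (simp add: power_le_one)
    moreover have "(2 * ?s + ?M A)\<^sup>2 \<le> 8 * ?s\<^sup>2 + 2 * (?M A)\<^sup>2"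
    proof -
      have "(2 * x + y)\<^sup>2 \<le> 8 * x\<^sup>2 + 2 * y\<^sup>2" for x y :: real
        using zero_le_power2[of "2 * x - y"] by (simp add: power2_eq_square algebra_simps)
      then show ?thesis .
    qed
    ultimately show ?thesis using gain_sum_eq[OF A] by simp
  qed
  then have "cube_avg V (\<lambda>A. (\<Sum>j\<in>V. gain f j A)\<^sup>2) \<le> cube_avg V (\<lambda>A. 8 + 2 * (?M A)\<^sup>2)"
    by (intro cube_avg_mono)
  also have "\<dots> = 8 + 2 * (\<Sum>j\<in>V. cube_avg V (\<lambda>A. (gain f j A)\<^sup>2))"
    using finite_V by (simp add: cube_avg_add cube_avg_cmult cube_avg_const gain_martingale_square)
  also have "\<dots> \<le> 12" using gain_square_sum alpha by simp
  finally show ?thesis .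
qed

lemma pos_marginal_total_square: "cube_avg V (\<lambda>A. (\<Sum>j\<in>V. pos_marginal f j A)\<^sup>2) \<le> 12"
proof -
  have "cube_avg V (\<lambda>A. (\<Sum>j\<in>V. pos_marginal f j A)\<^sup>2) \<le> cube_avg V (\<lambda>A. (\<Sum>j\<in>V. gain f j A)\<^sup>2)"
    by (intro cube_avg_mono power_mono sum_mono sum_nonneg pos_marginal_le_gain[OF submodular])
      (auto simp: pos_marginal_def)
  with gain_total_square show ?thesis by simp
qed

lemma complement: "lipschitz_submodular V (\<lambda>A. f (V - A)) \<alpha>"
proof
  show "submodular_on V (\<lambda>A. f (V - A))"
    by (rule submodular_on_complement[OF submodular])
qed (use finite_V range marginal_bound alpha in \<open>auto simp: marginal_complement\<close>)

text \<open>The total is a difference of positive parts, one of \<open>f\<close> and one of its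
  complemented function, each with second moment at most 12; hence 2 * 12 + 2 * 12.\<close>

lemma total_marginal_square: "cube_avg V (\<lambda>A. (\<Sum>i\<in>V. marginal f i A)\<^sup>2) \<le> 48"
proof -
  interpret c: lipschitz_submodular V "\<lambda>A. f (V - A)" \<alpha> by (rule complement)
  let ?p = "\<lambda>A. \<Sum>i\<in>V. pos_marginal f i A"
  let ?n = "\<lambda>A. \<Sum>i\<in>V. pos_marginal (\<lambda>A. f (V - A)) i A"
  have "(\<Sum>i\<in>V. marginal f i A)\<^sup>2 \<le> 2 * (?p A)\<^sup>2 + 2 * (?n (V - A))\<^sup>2" if A: "A \<subseteq> V" for A
  proof -
    have "marginal f i A = pos_marginal f i A - pos_marginal (\<lambda>A. f (V - A)) i (V - A)"
      if "i \<in> V" for i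
      using that A by (simp add: pos_marginal_def marginal_complement double_diff)
    then have "(\<Sum>i\<in>V. marginal f i A) = ?p A - ?n (V - A)"
      by (simp add: sum_subtractf)
    moreover have "(x - y)\<^sup>2 \<le> 2 * x\<^sup>2 + 2 * y\<^sup>2" for x y :: real
      using zero_le_power2[of "x + y"] by (simp add: power2_eq_square algebra_simps)
    ultimately show ?thesis by presburger
  qed
  then have "cube_avg V (\<lambda>A. (\<Sum>i\<in>V. marginal f i A)\<^sup>2)
      \<le> cube_avg V (\<lambda>A. 2 * (?p A)\<^sup>2 + 2 * (?n (V - A))\<^sup>2)"
    by (intro cube_avg_mono)
  also have "\<dots> = 2 * cube_avg V (\<lambda>A. (?p A)\<^sup>2) + 2 * cube_avg V (\<lambda>A. (?n A)\<^sup>2)"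
    using cube_avg_complement[OF finite_V, of "\<lambda>A. (?n A)\<^sup>2"]
    by (simp add: cube_avg_add cube_avg_cmult)
  also have "\<dots> \<le> 48"
    using pos_marginal_total_square c.pos_marginal_total_square by simp
  finally show ?thesis .
qed

lemma second_marginal_nonpos:
  "A \<subseteq> V \<Longrightarrow> i \<in> V \<Longrightarrow> j \<in> V \<Longrightarrow> marginal (marginal f i) j A \<le> 0"
  using marginal_antimono[OF submodular, of "A - {j}" "insert j A" i]
  by (auto simp: marginal_def[of "marginal _ _"])

text \<open>Flipping coordinate \<open>j\<close> is charged to the martingale \<open>M = \<Sum>j. cube_sign j * gain f j\<close>,
  whose increments dominate the positive marginals.\<close>

lemma weighted_second_marginal_pos:
  "(\<Sum>j\<in>V. \<Sum>i\<in>V. cube_avg V (\<lambda>A. pos_marginal f j A * \<bar>marginal (marginal f i) j A\<bar>))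
     \<le> 50 * sqrt \<alpha>"
proof -
  define G where "G A = (\<Sum>i\<in>V. marginal f i A)" for A
  let ?M = "\<lambda>A. \<Sum>j\<in>V. cube_sign j A * gain f j A"
  have dG: "marginal G j A = (\<Sum>i\<in>V. marginal (marginal f i) j A)" for j A
    by (simp add: G_def marginal_def[of G] marginal_def[of "marginal f _"] sum_subtractf)
  have "(\<Sum>j\<in>V. \<Sum>i\<in>V. cube_avg V (\<lambda>A. pos_marginal f j A * \<bar>marginal (marginal f i) j A\<bar>))
      = (\<Sum>j\<in>V. cube_avg V (\<lambda>A. pos_marginal f j A * (- marginal G j A)))"
    unfolding cube_avg_sum[symmetric] dG
    by (intro sum.cong refl cube_avg_cong)
      (simp add: second_marginal_nonpos abs_of_nonpos sum_negf flip: sum_distrib_left)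
  \<comment> \<open>Gains may replace positive marginals because second derivatives are nonpositive,
    which makes the other factor nonnegative.\<close>
  also have "\<dots> \<le> (\<Sum>j\<in>V. cube_avg V (\<lambda>A. gain f j A * (- marginal G j A)))"
  proof (intro sum_mono cube_avg_mono mult_right_mono)
    fix j A assume "j \<in> V" "A \<subseteq> V"
    then show "pos_marginal f j A \<le> gain f j A" "0 \<le> - marginal G j A"
      using pos_marginal_le_gain[OF submodular]
      by (auto simp: dG intro!: sum_nonpos second_marginal_nonpos)
  qed
  \<comment> \<open>Summation by parts: \<open>gain f j\<close> is constant in direction
    \<open>j\<close>, so under the average, differentiating \<open>G\<close> there amounts to
    multiplying it by twice the sign and negating.\<close>
  also have "\<dots> = (\<Sum>j\<in>V. 2 * cube_avg V (\<lambda>A. cube_sign j A * (gain f j A * G A)))"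
  proof (intro sum.cong refl)
    fix j assume j: "j \<in> V"
    have "2 * cube_avg V (\<lambda>A. cube_sign j A * (gain f j A * G A))
        = cube_avg V (\<lambda>A. 2 * ((gain f j (A - {j}) * G (A - {j})
            - gain f j (insert j A) * G (insert j A)) / 2))"
      by (simp only: cube_avg_sign_mult[OF finite_V j] cube_avg_cmult)
    also have "\<dots> = cube_avg V (\<lambda>A. gain f j A * (- marginal G j A))"
      by (rule cube_avg_cong) (simp add: gain_indep marginal_def right_diff_distrib)
    finally show "cube_avg V (\<lambda>A. gain f j A * (- marginal G j A))
        = 2 * cube_avg V (\<lambda>A. cube_sign j A * (gain f j A * G A))" by simp
  qed
  also have "\<dots> = cube_avg V (\<lambda>A. \<Sum>j\<in>V. 2 * (cube_sign j A * (gain f j A * G A)))"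
    by (simp only: cube_avg_cmult cube_avg_sum)
  also have "\<dots> = cube_avg V (\<lambda>A. 2 * (G A * ?M A))"
    by (rule cube_avg_cong) (simp add: sum_distrib_left mult_ac)
  \<comment> \<open>The weight \<open>sqrt \<alpha>\<close> balances the second moment of
    \<open>G\<close>, bounded by a constant, against that of the martingale, of order
    \<alpha>.\<close>
  also have "\<dots> \<le> cube_avg V (\<lambda>A. sqrt \<alpha> * (G A)\<^sup>2 + (1 / sqrt \<alpha>) * (?M A)\<^sup>2)"
  proof (rule cube_avg_mono)
    fix A
    have "2 * (x * y) \<le> s * x\<^sup>2 + (1 / s) * y\<^sup>2" if "s > 0" for x y s :: real
    proof -
      have "s * x\<^sup>2 + (1 / s) * y\<^sup>2 - 2 * (x * y) = (1 / s) * (s * x - y)\<^sup>2"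
        using that by (simp add: power2_eq_square field_simps)
      moreover have "\<dots> \<ge> 0" using that by simp
      ultimately show ?thesis by linarith
    qed
    then show "2 * (G A * ?M A) \<le> sqrt \<alpha> * (G A)\<^sup>2 + (1 / sqrt \<alpha>) * (?M A)\<^sup>2"
      using alpha by simp
  qed
  also have "\<dots> = sqrt \<alpha> * cube_avg V (\<lambda>A. (G A)\<^sup>2)
      + (1 / sqrt \<alpha>) * (\<Sum>j\<in>V. cube_avg V (\<lambda>A. (gain f j A)\<^sup>2))"
    by (simp only: cube_avg_add cube_avg_cmult gain_martingale_square[OF finite_V])
  also have "\<dots> \<le> sqrt \<alpha> * 48 + (1 / sqrt \<alpha>) * (2 * \<alpha>)"
    using total_marginal_square gain_square_sum alpha
    by (intro add_mono mult_left_mono) (auto simp: G_def)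
  also have "(1 / sqrt \<alpha>) * (2 * \<alpha>) = 2 * sqrt \<alpha>"
    using alpha real_div_sqrt[of \<alpha>] by simp
  finally show ?thesis by simp
qed

text \<open>An absolute marginal is the positive marginal of \<open>f\<close> plus that of the
  complemented function at \<open>V - A\<close>. Second derivatives are unchanged by
  complementation, so the one-sided bound is used twice.\<close>

lemma weighted_second_marginal:
  "(\<Sum>j\<in>V. \<Sum>i\<in>V. cube_avg V (\<lambda>A. \<bar>marginal f j A\<bar> * \<bar>marginal (marginal f i) j A\<bar>))
     \<le> 100 * sqrt \<alpha>"
proof -
  interpret c: lipschitz_submodular V "\<lambda>A. f (V - A)" \<alpha> by (rule complement)
  let ?f' = "\<lambda>A. f (V - A)"
  let ?P = "\<lambda>i j A. pos_marginal f j A * \<bar>marginal (marginal f i) j A\<bar>"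
  let ?N = "\<lambda>i j A. pos_marginal ?f' j A * \<bar>marginal (marginal ?f' i) j A\<bar>"
  have "cube_avg V (\<lambda>A. \<bar>marginal f j A\<bar> * \<bar>marginal (marginal f i) j A\<bar>)
      = cube_avg V (?P i j) + cube_avg V (?N i j)" if ij: "i \<in> V" "j \<in> V" for i j
  proof -
    have "\<bar>marginal f j A\<bar> * \<bar>marginal (marginal f i) j A\<bar> = ?P i j A + ?N i j (V - A)"
      if A: "A \<subseteq> V" for A
    proof -
      have "V - insert j (V - A) = A - {j}" "V - (V - A - {j}) = insert j A"
        using A ij by auto
      moreover have "insert j (V - A) \<subseteq> V" "V - A - {j} \<subseteq> V" using ij by auto
      ultimately have "marginal (marginal ?f' i) j (V - A) = marginal (marginal f i) j A"
        unfolding marginal_def[of "marginal _ i"] using ij by (simp add: marginal_complement)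
      moreover have "\<bar>marginal f j A\<bar> = pos_marginal f j A + pos_marginal ?f' j (V - A)"
        using ij A by (simp add: pos_marginal_def marginal_complement double_diff)
      ultimately show ?thesis by (simp add: distrib_right)
    qed
    then have "cube_avg V (\<lambda>A. \<bar>marginal f j A\<bar> * \<bar>marginal (marginal f i) j A\<bar>)
        = cube_avg V (\<lambda>A. ?P i j A + ?N i j (V - A))"
      by (intro cube_avg_cong)
    then show ?thesis
      by (simp only: cube_avg_add cube_avg_complement[OF finite_V, of "?N i j"])
  qed
  then have "(\<Sum>j\<in>V. \<Sum>i\<in>V. cube_avg V (\<lambda>A. \<bar>marginal f j A\<bar> * \<bar>marginal (marginal f i) j A\<bar>))
      = (\<Sum>j\<in>V. \<Sum>i\<in>V. cube_avg V (?P i j)) + (\<Sum>j\<in>V. \<Sum>i\<in>V. cube_avg V (?N i j))"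
    by (simp add: sum.distrib)
  with weighted_second_marginal_pos c.weighted_second_marginal_pos show ?thesis by simp
qed

text \<open>One factor of the square is bounded by the marginals at the two ends of the edge in
  direction \<open>i\<close>. The other is constant on that edge, so averaging over both ends gives
  the factor 2.\<close>

lemma second_marginal_square_le:
  assumes ij: "i \<in> V" "j \<in> V" "i \<noteq> j"
  shows "cube_avg V (\<lambda>A. (marginal (marginal f i) j A)\<^sup>2)
    \<le> 2 * cube_avg V (\<lambda>A. \<bar>marginal f j A\<bar> * \<bar>marginal (marginal f i) j A\<bar>)"
proof -
  let ?D = "marginal (marginal f i) j"
  have D: "?D A = marginal f j (insert i A) - marginal f j (A - {i})" for A
    using marginal_commute[OF ij(3)] by (simp add: marginal_def[of "marginal f j"])
  have D_indep: "?D (insert i A) = ?D A" "?D (A - {i}) = ?D A" for A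
    by (simp_all add: D)
  have "cube_avg V (\<lambda>A. (?D A)\<^sup>2)
     \<le> cube_avg V (\<lambda>A. 2 * ((\<bar>marginal f j (insert i A)\<bar> * \<bar>?D (insert i A)\<bar>
            + \<bar>marginal f j (A - {i})\<bar> * \<bar>?D (A - {i})\<bar>) / 2))"
  proof (rule cube_avg_mono)
    fix A
    have "(?D A)\<^sup>2 = \<bar>?D A\<bar> * \<bar>?D A\<bar>" by (simp add: power2_eq_square)
    also have "\<dots> \<le> (\<bar>marginal f j (insert i A)\<bar> + \<bar>marginal f j (A - {i})\<bar>) * \<bar>?D A\<bar>"
      by (intro mult_right_mono) (auto simp: D)
    finally show "(?D A)\<^sup>2 \<le> 2 * ((\<bar>marginal f j (insert i A)\<bar> * \<bar>?D (insert i A)\<bar>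
            + \<bar>marginal f j (A - {i})\<bar> * \<bar>?D (A - {i})\<bar>) / 2)"
      unfolding D_indep by (simp add: distrib_right)
  qed
  also have "\<dots> = 2 * cube_avg V (\<lambda>A. \<bar>marginal f j A\<bar> * \<bar>?D A\<bar>)"
    by (subst (2) cube_avg_split[OF finite_V ij(1)]) (rule cube_avg_cmult)
  finally show ?thesis .
qed

lemma second_marginal_square_sum:
  "(\<Sum>i\<in>V. \<Sum>j\<in>V. cube_avg V (\<lambda>A. (marginal (marginal f i) j A)\<^sup>2)) \<le> 200 * sqrt \<alpha>"
proof -
  have "(\<Sum>i\<in>V. \<Sum>j\<in>V. cube_avg V (\<lambda>A. (marginal (marginal f i) j A)\<^sup>2))
      \<le> (\<Sum>i\<in>V. \<Sum>j\<in>V. 2 * cube_avg V (\<lambda>A. \<bar>marginal f j A\<bar> * \<bar>marginal (marginal f i) j A\<bar>))"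
  proof (intro sum_mono)
    fix i j assume "i \<in> V" "j \<in> V"
    then show "cube_avg V (\<lambda>A. (marginal (marginal f i) j A)\<^sup>2)
      \<le> 2 * cube_avg V (\<lambda>A. \<bar>marginal f j A\<bar> * \<bar>marginal (marginal f i) j A\<bar>)"
      using second_marginal_square_le[of i j]
      by (cases "i = j") (simp_all add: marginal_marginal_same cube_avg_const finite_V)
  qed
  also have "\<dots> = 2 * (\<Sum>j\<in>V. \<Sum>i\<in>V. cube_avg V (\<lambda>A. \<bar>marginal f j A\<bar> * \<bar>marginal (marginal f i) j A\<bar>))"
    by (subst sum.swap) (simp add: sum_distrib_left)
  also have "\<dots> \<le> 200 * sqrt \<alpha>" using weighted_second_marginal by simp
  finally show ?thesis .
qed

lemma lowdeg_approx:
  assumes "d > 0"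
  shows "\<exists>h. lowdeg V d h \<and> cube_avg V (\<lambda>A. (f A - h A)\<^sup>2) \<le> 25 / 2 * sqrt \<alpha> / (real d)\<^sup>2"
proof -
  obtain h where h: "lowdeg V d h"
    "16 * (real d)\<^sup>2 * cube_avg V (\<lambda>A. (f A - h A)\<^sup>2)
      \<le> (\<Sum>i\<in>V. \<Sum>j\<in>V. cube_avg V (\<lambda>A. (marginal (marginal f i) j A)\<^sup>2))"
    using walsh_truncation[OF finite_V] by blast
  then have "16 * (real d)\<^sup>2 * cube_avg V (\<lambda>A. (f A - h A)\<^sup>2) \<le> 200 * sqrt \<alpha>"
    using second_marginal_square_sum by simp
  then show ?thesis using h(1) assms by (intro exI[of _ h]) (simp add: field_simps)
qed

end

subsection \<open>Reduction to Lipschitz functions\<close>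

text \<open>A decision tree that queries a coordinate \<open>i\<close> with \<open>marginal f i {} > \<alpha>\<close>: the answer 1 raises
  \<open>f {}\<close> by more than \<open>\<alpha>\<close>, so at most \<open>k\<close> such answers occur on a path, and a path of length \<open>t\<close> is
  cut off with probability at most \<open>3 ^ k * (2 / 3) ^ t\<close>.\<close>

lemma decision_tree_approx:
  fixes K :: "nat set \<Rightarrow> (nat set \<Rightarrow> real) \<Rightarrow> bool" and \<alpha> \<delta> :: real
  assumes restrict: "\<And>V f i. K V f \<Longrightarrow> i \<in> V \<Longrightarrow>
        K (V - {i}) f \<and> K (V - {i}) (\<lambda>A. f (insert i A))"
    and range: "\<And>V f A. K V f \<Longrightarrow> A \<subseteq> V \<Longrightarrow> 0 \<le> f A \<and> f A \<le> 1"
    and submodular: "\<And>V f. K V f \<Longrightarrow> submodular_on V f"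
    and leaf: "\<And>V f. K V f \<Longrightarrow> finite V \<Longrightarrow> (\<And>A i. A \<subseteq> V \<Longrightarrow> i \<in> V \<Longrightarrow> marginal f i A \<le> \<alpha>) \<Longrightarrow>
        \<exists>h. lowdeg V d h \<and> cube_avg V (\<lambda>A. (f A - h A)\<^sup>2) \<le> \<delta>"
    and pos: "0 < \<alpha>" "0 \<le> \<delta>"
  assumes "K V f" "finite V" "1 - real k * \<alpha> < f {}"
  shows "\<exists>h. lowdeg V (d + t) h \<and> cube_avg V (\<lambda>A. (f A - h A)\<^sup>2) \<le> \<delta> + 3 ^ k * (2 / 3) ^ t"
  using assms(7-9)
proof (induction t arbitrary: V f k)
  \<comment> \<open>With no queries left the answer is 0, whose squared error is at most 1.\<close>
  case 0
  have "cube_avg V (\<lambda>A. (f A - 0)\<^sup>2) \<le> cube_avg V (\<lambda>A. 1)"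
    by (rule cube_avg_mono) (use range[OF "0.prems"(1)] in \<open>auto simp: power_le_one\<close>)
  also have "\<dots> \<le> 3 ^ k" using "0.prems" by (simp add: cube_avg_const)
  finally show ?case using pos
    by (intro exI[of _ "\<lambda>A. 0"]) (auto intro: lowdeg_const)
next
  case (Suc t)
  show ?case
  proof (cases "\<exists>i\<in>V. \<alpha> < marginal f i {}")
    case False
    \<comment> \<open>By diminishing returns marginals are largest at \<open>{}\<close>, so the test
      there settles the bound on the whole cube.\<close>
    have "marginal f i A \<le> \<alpha>" if "A \<subseteq> V" "i \<in> V" for A i
      using marginal_antimono[OF submodular[OF Suc.prems(1)], of "{}" A i] that False by force
    then obtain h where h: "lowdeg V d h" "cube_avg V (\<lambda>A. (f A - h A)\<^sup>2) \<le> \<delta>"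
      using leaf[OF Suc.prems(1,2)] by blast
    have "lowdeg V (d + Suc t) h" using h(1) by (rule lowdeg_mono) auto
    moreover have "0 \<le> (3::real) ^ k * (2 / 3) ^ Suc t" by simp
    ultimately show ?thesis using h(2) by (intro exI[of _ h]) linarith
  next
    case True
    then obtain i where i: "i \<in> V" "\<alpha> < f {i} - f {}" by (auto simp: marginal_def)
    let ?W = "V - {i}" and ?f1 = "\<lambda>A. f (insert i A)"
    have W: "finite ?W" "i \<notin> ?W" "insert i ?W = V" using Suc.prems i by auto
    note K = restrict[OF Suc.prems(1) i(1)]
    \<comment> \<open>\<open>k\<close> is the budget of answers 1. It cannot be exhausted here,
      since \<open>f {i}\<close> exceeds \<open>f {}\<close> by more than \<alpha> and is still at
      most 1.\<close>
    have "f {i} \<le> 1" using range[OF Suc.prems(1), of "{i}"] i by auto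
    then have "k \<noteq> 0" using i Suc.prems(3) pos by (intro notI) simp
    then obtain k' where k: "k = Suc k'" using not0_implies_Suc by blast
    have "1 - real k' * \<alpha> < ?f1 {}" using i Suc.prems(3) by (simp add: k algebra_simps)
    then obtain h1 where h1: "lowdeg ?W (d + t) h1"
      "cube_avg ?W (\<lambda>A. (?f1 A - h1 A)\<^sup>2) \<le> \<delta> + 3 ^ k' * (2 / 3) ^ t"
      using Suc.IH[of ?W ?f1 k'] K W by blast
    obtain h0 where h0: "lowdeg ?W (d + t) h0"
      "cube_avg ?W (\<lambda>A. (f A - h0 A)\<^sup>2) \<le> \<delta> + 3 ^ k * (2 / 3) ^ t"
      using Suc.IH[of ?W f k] K W Suc.prems by blast
    define h where "h A = (if i \<in> A then h1 A else h0 A)" for A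
    have "lowdeg V (d + Suc t) h"
      using lowdeg_branch[OF h0(1) h1(1), of i] W by (simp add: h_def[abs_def])
    moreover have "cube_avg V (\<lambda>A. (f A - h A)\<^sup>2) \<le> \<delta> + 3 ^ k * (2 / 3) ^ Suc t"
    proof -
      have "cube_avg V (\<lambda>A. (f A - h A)\<^sup>2)
          = (cube_avg ?W (\<lambda>A. (f A - h A)\<^sup>2) + cube_avg ?W (\<lambda>A. (?f1 A - h (insert i A))\<^sup>2)) / 2"
        using cube_avg_insert[OF W(1,2)] unfolding W(3) .
      also have "cube_avg ?W (\<lambda>A. (f A - h A)\<^sup>2) = cube_avg ?W (\<lambda>A. (f A - h0 A)\<^sup>2)"
        by (rule cube_avg_cong) (auto simp: h_def)
      also have "cube_avg ?W (\<lambda>A. (?f1 A - h (insert i A))\<^sup>2) = cube_avg ?W (\<lambda>A. (?f1 A - h1 A)\<^sup>2)"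
        using lowdeg_indep[OF h1(1) W(2)] by (intro cube_avg_cong) (simp add: h_def)
      also have "(cube_avg ?W (\<lambda>A. (f A - h0 A)\<^sup>2) + cube_avg ?W (\<lambda>A. (?f1 A - h1 A)\<^sup>2)) / 2
          \<le> ((\<delta> + 3 ^ k * (2 / 3) ^ t) + (\<delta> + 3 ^ k' * (2 / 3) ^ t)) / 2"
        using h0(2) h1(2) by simp
      \<comment> \<open>The average of \<open>3 ^ k\<close> and \<open>3 ^ (k - 1)\<close> is
        \<open>2 / 3 * 3 ^ k\<close>, which explains the two bases in the bound.\<close>
      also have "\<dots> = \<delta> + 3 ^ k * (2 / 3) ^ Suc t" by (simp add: k field_simps)
      finally show ?thesis .
    qed
    ultimately show ?thesis by blast
  qed
qed

section \<open>Two-sided reduction and choice of parameters\<close>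

lemma submodular_on_restrict:
  assumes "submodular_on V f"
  shows "submodular_on (V - {i}) f" "i \<in> V \<Longrightarrow> submodular_on (V - {i}) (\<lambda>A. f (insert i A))"
proof -
  show "submodular_on (V - {i}) f" using assms unfolding submodular_on_def by blast
  assume i: "i \<in> V"
  show "submodular_on (V - {i}) (\<lambda>A. f (insert i A))"
    unfolding submodular_on_def
  proof (intro allI impI)
    fix A B assume "A \<subseteq> V - {i}" "B \<subseteq> V - {i}"
    then have "f (insert i A \<union> insert i B) + f (insert i A \<inter> insert i B)
        \<le> f (insert i A) + f (insert i B)"
      using i by (intro assms[unfolded submodular_on_def, rule_format]) auto
    then show "f (insert i (A \<union> B)) + f (insert i (A \<inter> B)) \<le> f (insert i A) + f (insert i B)"
      by (simp add: insert_commute)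
  qed
qed

text \<open>Two nested trees. The outer one removes marginals above \<alpha>. At its leaves the
  complemented function has marginals at least -\<alpha>, a bound inherited by restrictions, and an
  inner tree on it again removes those above \<alpha>. Hence \<open>t\<close> and the tree error
  occur twice.\<close>

lemma submodular_approx:
  fixes \<alpha> :: real
  assumes V: "finite V" and f: "submodular_on V f"
    and range: "\<And>A. A \<subseteq> V \<Longrightarrow> 0 \<le> f A \<and> f A \<le> 1"
    and \<alpha>: "0 < \<alpha>" "\<alpha> \<le> 1" and d: "d > 0" and k: "1 < real k * \<alpha>"
  shows "\<exists>h. lowdeg V (d + t + t) h \<and> cube_avg V (\<lambda>A. (f A - h A)\<^sup>2)
           \<le> 25 / 2 * sqrt \<alpha> / (real d)\<^sup>2 + 3 ^ k * (2 / 3) ^ t + 3 ^ k * (2 / 3) ^ t"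
proof -
  define K0 where "K0 V f \<longleftrightarrow> submodular_on V f \<and> (\<forall>A\<subseteq>V. 0 \<le> f A \<and> f A \<le> 1)"
    for V :: "nat set" and f :: "nat set \<Rightarrow> real"
  define K1 where "K1 V f \<longleftrightarrow> K0 V f \<and> (\<forall>A\<subseteq>V. \<forall>i\<in>V. - \<alpha> \<le> marginal f i A)" for V f
  let ?\<delta> = "25 / 2 * sqrt \<alpha> / (real d)\<^sup>2" and ?\<eta> = "3 ^ k * (2 / 3) ^ t :: real"
  have restrict0: "K0 (V - {i}) f \<and> K0 (V - {i}) (\<lambda>A. f (insert i A))" if "K0 V f" "i \<in> V" for V f i
  proof -
    have "insert i A \<subseteq> V" if "A \<subseteq> V - {i}" for A using that \<open>i \<in> V\<close> by auto
    then show ?thesis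
      using that submodular_on_restrict[of V f i] unfolding K0_def by blast
  qed
  have restrict1: "K1 (V - {i}) f \<and> K1 (V - {i}) (\<lambda>A. f (insert i A))" if K: "K1 V f" "i \<in> V" for V f i
  proof -
    have "marginal (\<lambda>A. f (insert i A)) j A = marginal f j (insert i A)" if "j \<noteq> i" for j A
      using that by (simp add: marginal_def insert_commute insert_Diff_if)
    moreover have "insert i A \<subseteq> V" if "A \<subseteq> V - {i}" for A using that K by auto
    ultimately show ?thesis
      using that restrict0[of V f i] unfolding K1_def by auto
  qed
  have K0D: "submodular_on V f" "\<And>A. A \<subseteq> V \<Longrightarrow> 0 \<le> f A \<and> f A \<le> 1" if "K0 V f" for V f
    using that by (auto simp: K0_def)
  have K1D: "K0 V f" if "K1 V f" for V f
    using that by (simp add: K1_def)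
  have low: "\<exists>h. lowdeg V (d + t) h \<and> cube_avg V (\<lambda>A. (f A - h A)\<^sup>2) \<le> ?\<delta> + ?\<eta>"
    if "K1 V f" "finite V" for V f
  proof (rule decision_tree_approx[where K = K1 and \<alpha> = \<alpha>])
    show "\<exists>h. lowdeg V d h \<and> cube_avg V (\<lambda>A. (f A - h A)\<^sup>2) \<le> ?\<delta>"
      if "K1 V f" "finite V" "\<And>A i. A \<subseteq> V \<Longrightarrow> i \<in> V \<Longrightarrow> marginal f i A \<le> \<alpha>" for V f
    proof -
      have "lipschitz_submodular V f \<alpha>"
        using that \<alpha> unfolding K1_def K0_def by unfold_locales (auto simp: abs_le_iff minus_le_iff)
      then show ?thesis using d by (rule lipschitz_submodular.lowdeg_approx)
    qed
    \<comment> \<open>\<open>1 - real k * \<alpha>\<close> is negative, so nonnegativity of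
      \<open>f\<close> meets the budget condition.\<close>
    have "0 \<le> f {}" using that by (auto simp: K1_def K0_def)
    then show "1 - real k * \<alpha> < f {}" using k by linarith
  qed (fact restrict1 that K0D[OF K1D] | use \<alpha> in simp)+
  show ?thesis
  proof (rule decision_tree_approx[where K = K0 and \<alpha> = \<alpha> and d = "d + t" and \<delta> = "?\<delta> + ?\<eta>"])
    show "\<exists>h. lowdeg V (d + t) h \<and> cube_avg V (\<lambda>A. (f A - h A)\<^sup>2) \<le> ?\<delta> + ?\<eta>"
      if K: "K0 V f" and V: "finite V"
        and bound: "\<And>A i. A \<subseteq> V \<Longrightarrow> i \<in> V \<Longrightarrow> marginal f i A \<le> \<alpha>" for V f
    proof -
      have "K1 V (\<lambda>A. f (V - A))"
        using K bound submodular_on_complement[of V f]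
        unfolding K1_def K0_def by (auto simp: marginal_complement)
      then obtain h where h: "lowdeg V (d + t) h"
        "cube_avg V (\<lambda>A. (f (V - A) - h A)\<^sup>2) \<le> ?\<delta> + ?\<eta>" using low V by blast
      obtain h' where h': "lowdeg V (d + t) h'" "\<forall>A\<subseteq>V. h' A = h (V - A)"
        using lowdeg_complement[OF h(1) V] by blast
      have "cube_avg V (\<lambda>A. (f A - h' A)\<^sup>2) = cube_avg V (\<lambda>A. (f (V - A) - h' (V - A))\<^sup>2)"
        using cube_avg_complement[OF V, of "\<lambda>A. (f A - h' A)\<^sup>2"] by simp
      also have "\<dots> = cube_avg V (\<lambda>A. (f (V - A) - h A)\<^sup>2)"
        using h'(2) by (intro cube_avg_cong) (auto simp: double_diff)
      finally show ?thesis using h(2) h'(1) by auto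
    qed
    have "0 \<le> f {}" using range by auto
    then show "1 - real k * \<alpha> < f {}" using k by linarith
    show "K0 V f" using f range by (simp add: K0_def)
  qed (fact restrict0 K0D V | use \<alpha> in simp)+
qed

text \<open>Parameters: Lipschitz constant \<open>1 / m\<close>, Walsh degree \<open>4 * m\<close>,
  depth \<open>17 * m\<close>, and budget \<open>m + 1\<close>, the least integer whose product with
  \<open>1 / m\<close> exceeds 1. Truncation uses 25/32 of the target and the trees at most
  6/40.\<close>

lemma tree_error_bound:
  assumes m: "m > 0"
  shows "25 / 2 * sqrt (1 / real m) / (real (4 * m))\<^sup>2
      + 3 ^ (m + 1) * (2 / 3) ^ (17 * m) + 3 ^ (m + 1) * (2 / 3) ^ (17 * m)
    \<le> real m powr (- 5 / 2)"
proof -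
  let ?r = "sqrt (1 / real m) / (real m)\<^sup>2"
  have "real m powr (- 5 / 2) = real m powr (- (1 / 2)) * real m powr (- 2)"
    by (simp flip: powr_add)
  also have "\<dots> = ?r"
    using m by (simp add: powr_minus powr_half_sqrt powr_numeral real_sqrt_divide divide_simps)
  finally have r: "real m powr (- 5 / 2) = ?r" .
  have "real m ^ 3 \<le> (2 ^ m) ^ 3"
    using of_nat_less_two_power[of m, where ?'a = real] by (intro power_mono) auto
  also have "(2 ^ m) ^ 3 = (2 ^ 3 :: real) ^ m"
    by (simp only: mult.commute flip: power_mult)
  finally have cube: "(1 / 8) ^ m \<le> 1 / real m ^ 3"
    using m by (simp add: power_one_over field_simps)
  have "1 / real m \<le> sqrt (1 / real m)"
    using m by (intro real_le_rsqrt) (simp add: power2_eq_square field_simps)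
  then have "1 / real m / (real m)\<^sup>2 \<le> ?r"
    by (intro divide_right_mono) auto
  with cube have small: "(1 / 8) ^ m \<le> ?r"
    by (simp add: power2_eq_square power3_eq_cube)
  have "3 ^ (m + 1) * (2 / 3) ^ (17 * m) + 3 ^ (m + 1) * (2 / 3) ^ (17 * m)
      = 6 * (3 * (2 / 3) ^ 17 :: real) ^ m"
    by (simp only: power_mult power_mult_distrib) simp
  \<comment> \<open>\<open>3 * (2 / 3) ^ 17\<close> lies just below 1/320. The factor
    \<open>(1 / 8) ^ m\<close> supplies the decay in \<open>m\<close>, and a single factor 1/40 the
    small constant.\<close>
  also have "\<dots> \<le> 6 * (1 / 40 * (1 / 8)) ^ m"
    by (intro mult_left_mono power_mono) (simp_all add: power_divide)
  also have "\<dots> = 6 * ((1 / 40) ^ m * (1 / 8) ^ m)"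
    by (simp only: power_mult_distrib)
  also have "\<dots> \<le> 6 * (1 / 40 * (1 / 8) ^ m)"
    using m power_decreasing[of 1 m "1 / 40 :: real"] by (intro mult_left_mono mult_right_mono) auto
  also have "\<dots> \<le> 6 * (1 / 40 * ?r)"
    using small by (intro mult_left_mono) auto
  finally have "3 ^ (m + 1) * (2 / 3) ^ (17 * m) + 3 ^ (m + 1) * (2 / 3) ^ (17 * m) \<le> 6 / 40 * ?r"
    by simp
  moreover have "25 / 2 * sqrt (1 / real m) / (real (4 * m))\<^sup>2 = 25 / 32 * ?r"
    by (simp add: power_mult_distrib)
  moreover have "0 \<le> ?r" by simp
  ultimately show ?thesis unfolding r by linarith
qed

theorem theorem4p9:
  "\<exists>C::real. C > 0 \<and>
     (\<forall>(n::nat) (f :: nat set \<Rightarrow> real) (\<epsilon>::real).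
        (\<forall>A. A \<subseteq> {1..n} \<longrightarrow> 0 \<le> f A \<and> f A \<le> 1) \<longrightarrow>
        submodular_on {1..n} f \<longrightarrow>
        \<epsilon> > 0 \<longrightarrow>
        (\<exists>p :: real_mpoly.
           mpoly_vars p \<subseteq> {1..n} \<and>
           real (mpoly_degree p) \<le> C * \<bar>1 / \<epsilon> powr (4/5) * ln (1 / \<epsilon>)\<bar> \<and>
           cube_l2_norm n (\<lambda>A. f A - mpoly_eval p (indicator A)) \<le> \<epsilon>))"
\<comment> \<open>152 is 38 * 2 * 2: for \<epsilon> < 1/2 the degree is at most
  \<open>38 * m\<close>, with \<open>m\<close> at most twice
  \<open>1 / \<epsilon> powr (4/5)\<close>, and the logarithm is at least 1/2.\<close>
proof (intro exI[of _ "152 :: real"] conjI allI impI)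
  fix n :: nat and f :: "nat set \<Rightarrow> real" and \<epsilon> :: real
  assume range: "\<forall>A. A \<subseteq> {1..n} \<longrightarrow> 0 \<le> f A \<and> f A \<le> 1"
    and f: "submodular_on {1..n} f" and \<epsilon>: "\<epsilon> > 0"
  have "\<exists>d h. lowdeg {1..n} d h \<and> real d \<le> 152 * \<bar>1 / \<epsilon> powr (4/5) * ln (1 / \<epsilon>)\<bar> \<and>
          cube_avg {1..n} (\<lambda>A. (f A - h A)\<^sup>2) \<le> \<epsilon>\<^sup>2"
  proof (cases "\<epsilon> < 1 / 2")
    \<comment> \<open>A constant is used because the degree bound vanishes at \<epsilon> = 1; the
      value 1/2 is within 1/2 of all of [0,1].\<close>
    case False
    have "cube_avg {1..n} (\<lambda>A. (f A - 1 / 2)\<^sup>2) \<le> cube_avg {1..n} (\<lambda>A. \<epsilon>\<^sup>2)"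
    proof (rule cube_avg_mono)
      fix A assume "A \<subseteq> {1..n}"
      then have "0 \<le> f A \<and> f A \<le> 1" using range by blast
      then have "\<bar>f A - 1 / 2\<bar> \<le> 1 / 2" by linarith
      then have "\<bar>f A - 1 / 2\<bar> \<le> \<bar>\<epsilon>\<bar>" using False by simp
      then show "(f A - 1 / 2)\<^sup>2 \<le> \<epsilon>\<^sup>2" by (simp only: abs_le_square_iff)
    qed
    then show ?thesis
      by (intro exI[of _ 0] exI[of _ "\<lambda>A. 1 / 2"]) (auto simp: cube_avg_const intro: lowdeg_const)
  next
    case True
    define y where "y = 1 / \<epsilon> powr (4/5)"
    define m where "m = nat \<lceil>y\<rceil>"
    have "\<epsilon> powr (4/5) \<le> 1" using \<epsilon> True by (intro powr_le1) auto
    then have y: "1 \<le> y" using \<epsilon> by (simp add: y_def)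
    then have m: "y \<le> real m" "real m \<le> y + 1" "m > 0" unfolding m_def by linarith+
    have "\<exists>h. lowdeg {1..n} (4 * m + 17 * m + 17 * m) h \<and> cube_avg {1..n} (\<lambda>A. (f A - h A)\<^sup>2)
        \<le> 25 / 2 * sqrt (1 / real m) / (real (4 * m))\<^sup>2
          + 3 ^ (m + 1) * (2 / 3) ^ (17 * m) + 3 ^ (m + 1) * (2 / 3) ^ (17 * m)"
      using m(3) range f by (intro submodular_approx) (auto simp: field_simps)
    then obtain h where h: "lowdeg {1..n} (38 * m) h"
      "cube_avg {1..n} (\<lambda>A. (f A - h A)\<^sup>2) \<le> real m powr (- 5 / 2)"
      using tree_error_bound[OF m(3)] by (fastforce intro: order_trans)
    have "real m powr (- 5 / 2) \<le> y powr (- 5 / 2)"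
      using y m by (intro powr_mono2') auto
    \<comment> \<open>The exponent 4/5 comes from here: its product with 5/2 is 2, so the squared
      error matches \<open>\<epsilon>\<^sup>2\<close>.\<close>
    also have "y = \<epsilon> powr (- 4 / 5)"
      using powr_minus[of \<epsilon> "4 / 5"] by (simp add: y_def inverse_eq_divide)
    also have "(\<epsilon> powr (- 4 / 5)) powr (- 5 / 2) = \<epsilon>\<^sup>2"
      using \<epsilon> by (simp add: powr_powr powr_numeral)
    finally have err: "cube_avg {1..n} (\<lambda>A. (f A - h A)\<^sup>2) \<le> \<epsilon>\<^sup>2" using h(2) by simp
    have "ln 2 \<le> ln (1 / \<epsilon>)" using \<epsilon> True by (subst ln_le_cancel_iff) (auto simp: field_simps)
    then have ln: "1 / 2 \<le> ln (1 / \<epsilon>)" using ln2_ge_two_thirds by linarith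
    have "real (38 * m) \<le> 152 * (y * (1 / 2))" using m y by simp
    also have "\<dots> \<le> 152 * (y * ln (1 / \<epsilon>))" using ln y by (intro mult_left_mono) auto
    also have "\<dots> \<le> 152 * \<bar>1 / \<epsilon> powr (4/5) * ln (1 / \<epsilon>)\<bar>"
      unfolding y_def by (intro mult_left_mono abs_ge_self) auto
    finally show ?thesis using h(1) err by blast
  qed
  then obtain d h where h: "lowdeg {1..n} d h" "real d \<le> 152 * \<bar>1 / \<epsilon> powr (4/5) * ln (1 / \<epsilon>)\<bar>"
    "cube_avg {1..n} (\<lambda>A. (f A - h A)\<^sup>2) \<le> \<epsilon>\<^sup>2" by blast
  obtain p where p: "mpoly_vars p \<subseteq> {1..n}" "mpoly_degree p \<le> d"
    "\<forall>A. mpoly_eval p (indicator A) = h A"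
    using lowdeg_imp_mpoly[OF h(1)] by blast
  have "cube_l2_norm n (\<lambda>A. f A - mpoly_eval p (indicator A)) \<le> sqrt (\<epsilon>\<^sup>2)"
    unfolding cube_l2_norm_eq using h(3) p(3) by (intro real_sqrt_le_mono) simp
  then show "\<exists>p :: real_mpoly. mpoly_vars p \<subseteq> {1..n} \<and>
      real (mpoly_degree p) \<le> 152 * \<bar>1 / \<epsilon> powr (4/5) * ln (1 / \<epsilon>)\<bar> \<and>
      cube_l2_norm n (\<lambda>A. f A - mpoly_eval p (indicator A)) \<le> \<epsilon>"
    using p(1,2) h(2) \<epsilon> by (intro exI[of _ p]) auto
qed simp

end
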